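(* Assume that $m=12t$ for some integer $t\ge1$, and take the basis of $M_m$ given by $(E_4^3)^u(E_6^2)^{t-u}$, $0\le u\le t$. Then $$W_q\left((E_4^3)^u(E_6^2)^{t-u},\ 0\le u\le t\right)=\lambda\cdot\Delta^{\frac{t(t+1)}2}E_4^{t(t+1)}E_6^{\frac{t(t+1)}2}$$ for some non-zero constant $\lambda$.
   Context: $M_m$ is the space of all modular forms of weight $m$ for $SL_2(\mathbb Z)$, and $q=\exp(2\pi\sqrt{-1}z)$. $E_4=1+240\sum_{n\ge1}\sigma_3(n)q^n$ and $E_6=1-504\sum_{n\ge1}\sigma_5(n)q^n$ are the Eisenstein series of weights $4$ and $6$, where $\sigma_r(n)=\sum_{d\mid n}d^r$, and $\Delta=\frac{E_4^3-E_6^2}{1728}=q-24q^2+252q^3+\cdots$ is the Ramanujan delta function. For modular forms $g_1,\ldots,g_k$ viewed via their $q$-expansions, the $q$-Wronskian is $W_q(g_1,\ldots,g_k)=\det\left(\left(q\frac d{dq}\right)^{i-1}g_j\right)_{1\le i,j\le k}$. *)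

theory Defs
  imports
    "HOL-Computational_Algebra.Formal_Power_Series"
    "Jordan_Normal_Form.Determinant"
begin

text \<open>
  Modular forms for the full modular group are represented by their $q$-expansions, i.e.\ as formal power
  series over the complex numbers in the variable $q$ (which is \<^term>\<open>fps_X\<close>).
\<close>

definition divisor_sigma :: "nat \<Rightarrow> nat \<Rightarrow> nat" where
  "divisor_sigma r n = (\<Sum>d | d dvd n. d ^ r)"

definition E4 :: "complex fps" where
  "E4 = Abs_fps (\<lambda>n. if n = 0 then 1 else 240 * of_nat (divisor_sigma 3 n))"

definition E6 :: "complex fps" where
  "E6 = Abs_fps (\<lambda>n. if n = 0 then 1 else - 504 * of_nat (divisor_sigma 5 n))"

definition Ramanujan_Delta :: "complex fps" where
  "Ramanujan_Delta = fps_const (1 / 1728) * (E4 ^ 3 - E6 ^ 2)"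

definition q_deriv :: "complex fps \<Rightarrow> complex fps" where
  "q_deriv f = fps_X * fps_deriv f"

text \<open>
  The $q$-Wronskian of a finite sequence of $q$-expansions. Rows and columns are counted from
  \<open>0\<close>, so row \<open>i\<close> holds the \<open>i\<close>-th iterates of \<^const>\<open>q_deriv\<close>.
\<close>
definition q_Wronskian :: "complex fps list \<Rightarrow> complex fps" where
  "q_Wronskian gs =
     det (mat (length gs) (length gs) (\<lambda>(i, j). (q_deriv ^^ i) (gs ! j)))"

end

theory Submission
  imports Defs
begin

text \<open>
  Write $D = q\,d/dq$, $A = E_4^3$, $B = E_6^2$ and $f = A/B$; the quotient exists as a power series
  because $B$ has constant term $1$. The basis is the geometric sequence $B^t f^u$, and the Wronskian of
  a geometric sequence $h f^u$, $u < k$, is explicit: by the chain rule its matrix is a lower triangular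
  matrix with diagonal $i!\, h\, (Df)^i$ times the unitriangular matrix with entries
  ${j \choose l} f^{j-l}$ (\<open>q_Wronskian_mult_powers\<close>). With $h = B^t$ and
  $k = t + 1$ this gives a non-zero constant times $(B^2 Df)^{t(t+1)/2}$, and
  \[ B^2 Df = B\,DA - A\,DB = E_4^2 E_6\,(3 E_6\,DE_4 - 2 E_4\,DE_6). \]

  So everything rests on $3 E_6\,DE_4 - 2 E_4\,DE_6 = E_4^3 - E_6^2 = 1728\,\Delta$. This
  follows from Ramanujan's equations $3\,DE_4 = E_2 E_4 - E_6$ and
  $2\,DE_6 = E_2 E_6 - E_4^2$, since the two terms with $E_2$ cancel.

  Ramanujan's equations are statements about convolutions of divisor sums, that is, about sums of
  monomials $a^i b^j$ over the positive solutions of $ax + by = n$. They are proved here without modular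
  forms, by one combinatorial principle (\<open>sum_reps_telescope\<close>): the substitution
  $(a, b, x, y) \mapsto (a - b, b, x, x + y)$ preserves $ax + by$, and it
  makes the sum of $f(a, b) - f(a + b, b)$ collapse to the diagonals $a = b$ and $x = y$, provided that
  both functions are symmetric in $a$ and $b$. The diagonals are elementary sums over the divisors
  of $n$. The functions $a^4 + b^4 + (a - b)^4$, $a^6 + b^6 + (a - b)^6$ and $a^2 b^2 (a - b)^2$ yield
  the three convolutions that occur.
\<close>

section \<open>Sums over the solutions of $ax + by = n$\<close>

definition reps :: "nat \<Rightarrow> (nat \<times> nat \<times> nat \<times> nat) set" where
  "reps n = {(a, b, x, y). 0 < a \<and> 0 < b \<and> 0 < x \<and> 0 < y \<and> a * x + b * y = n}"

lemma finite_reps [simp]: "finite (reps n)"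
proof (rule finite_subset)
  have "a \<le> n \<and> b \<le> n \<and> x \<le> n \<and> y \<le> n" if "(a, b, x, y) \<in> reps n" for a b x y
  proof -
    have p: "0 < a" "0 < b" "0 < x" "0 < y" "a * x + b * y = n"
      using that by (simp_all add: reps_def)
    have "a \<le> a * x" "x \<le> a * x" "b \<le> b * y" "y \<le> b * y" using p by simp_all
    then show ?thesis using p(5) by linarith
  qed
  then show "reps n \<subseteq> {..n} \<times> {..n} \<times> {..n} \<times> {..n}" by auto
qed simp

lemma sum_reps_swap:
  "(\<Sum>(a, b, x, y) \<in> reps n. F a b x y) = (\<Sum>(a, b, x, y) \<in> reps n. F b a y x)"
  by (rule sum.reindex_bij_witness[of _ "\<lambda>(a, b, x, y). (b, a, y, x)" "\<lambda>(a, b, x, y). (b, a, y, x)"])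
     (auto simp: reps_def add.commute)

text \<open>
  The substitution $(a, b, x, y) \mapsto (a - b, b, x, x + y)$, a step of the Euclidean
  algorithm on $(a, b)$ compensated on $(x, y)$, turns the condition $b < a$ into $x < y$.
\<close>
lemma sum_reps_shift:
  "(\<Sum>(a, b, x, y) \<in> reps n. if b < a then F a b else 0) =
   (\<Sum>(a, b, x, y) \<in> reps n. if x < y then F (a + b) b else 0)"
  (is "sum ?l _ = sum ?r _")
proof -
  have "sum ?l (reps n) = (\<Sum>(a, b, x, y) \<in> {(a, b, x, y) \<in> reps n. b < a}. F a b)"
    by (rule sum.mono_neutral_cong_right) (auto split: if_splits)
  also have "\<dots> = (\<Sum>(a, b, x, y) \<in> {(a, b, x, y) \<in> reps n. x < y}. F (a + b) b)"
    by (rule sum.reindex_bij_witness[of _ "\<lambda>(a, b, x, y). (a + b, b, x, y - x)"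
          "\<lambda>(a, b, x, y). (a - b, b, x, x + y)"])
       (auto simp: reps_def algebra_simps diff_mult_distrib diff_mult_distrib2
             intro!: le_add_diff_inverse trans_le_add1 mult_le_mono1)
  also have "\<dots> = sum ?r (reps n)"
    by (rule sum.mono_neutral_cong_left) (auto split: if_splits)
  finally show ?thesis .
qed

text \<open>
  If $a = b = d$, the equation reads $d (x + y) = n$, which has $n/d - 1$ solutions $(x, y)$ for each
  divisor $d$ of $n$.
\<close>
lemma sum_reps_diagonal_ab:
  fixes f :: "nat \<Rightarrow> 'a::comm_ring_1"
  assumes "0 < n"
  shows "(\<Sum>(a, b, x, y) \<in> reps n. if a = b then f a else 0) =
    (\<Sum>d | d dvd n. (of_nat (n div d) - 1) * f d)"
proof -
  have "(\<Sum>(a, b, x, y) \<in> reps n. if a = b then f a else 0) =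
      (\<Sum>(a, b, x, y) \<in> {(a, b, x, y) \<in> reps n. a = b}. f a)"
    by (rule sum.mono_neutral_cong_right) (auto split: if_splits)
  also have "\<dots> = (\<Sum>(d, x) \<in> Sigma {d. d dvd n} (\<lambda>d. {0<..<n div d}). f d)"
    by (rule sum.reindex_bij_witness[of _ "\<lambda>(d, x). (d, d, x, n div d - x)" "\<lambda>(a, b, x, y). (a, x)"])
       (use assms in \<open>auto simp: reps_def dvd_def simp flip: distrib_left\<close>)
  also have "\<dots> = (\<Sum>d | d dvd n. \<Sum>x \<in> {0<..<n div d}. f d)"
    by (rule sum.Sigma[symmetric]) (use assms in auto)
  also have "\<dots> = (\<Sum>d | d dvd n. (of_nat (n div d) - 1) * f d)"
  proof (rule sum.cong)
    fix d assume "d \<in> {d. d dvd n}"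
    then have "1 \<le> n div d" using assms by (auto simp: dvd_def)
    then have "of_nat (n div d - 1) = (of_nat (n div d) - 1 :: 'a)" by (simp add: of_nat_diff)
    then show "(\<Sum>x \<in> {0<..<n div d}. f d) = (of_nat (n div d) - 1) * f d" by simp
  qed simp
  finally show ?thesis .
qed

text \<open>
  If $x = y$, then $d = a + b$ is a divisor of $n$, and $b$ ranges over the positive integers
  below $d$.
\<close>
lemma sum_reps_diagonal_xy:
  assumes "0 < n"
  shows "(\<Sum>(a, b, x, y) \<in> reps n. if x = y then F (a + b) b else 0) =
    (\<Sum>d | d dvd n. \<Sum>b \<in> {0<..<d}. F d b)"
proof -
  have "(\<Sum>(a, b, x, y) \<in> reps n. if x = y then F (a + b) b else 0) =
      (\<Sum>(a, b, x, y) \<in> {(a, b, x, y) \<in> reps n. x = y}. F (a + b) b)"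
    by (rule sum.mono_neutral_cong_right) (auto split: if_splits)
  also have "\<dots> = (\<Sum>(d, b) \<in> Sigma {d. d dvd n} (\<lambda>d. {0<..<d}). F d b)"
    by (rule sum.reindex_bij_witness[of _ "\<lambda>(d, b). (d - b, b, n div d, n div d)" "\<lambda>(a, b, x, y). (a + b, b)"])
       (use assms in \<open>auto simp: reps_def dvd_def simp flip: distrib_right\<close>)
  also have "\<dots> = (\<Sum>d | d dvd n. \<Sum>b \<in> {0<..<d}. F d b)"
    by (rule sum.Sigma[symmetric]) (use assms in auto)
  finally show ?thesis .
qed

text \<open>
  Let $g(a, b) = f(a + b, b)$. Split the sum of $f$ by comparing $a$ with $b$, and the sum of $g$ by
  comparing $x$ with $y$. By symmetry the two off-diagonal parts of each sum agree, and the shift carries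
  the part $b < a$ of the first sum to the part $x < y$ of the second. Only the diagonals survive in the
  difference. The symmetry hypotheses hold for instance whenever $f(a, b)$ is a symmetric function of
  $a^2$, $b^2$ and $(a - b)^2$.
\<close>
theorem sum_reps_telescope:
  fixes f :: "nat \<Rightarrow> nat \<Rightarrow> 'a::comm_ring_1"
  assumes "0 < n"
    and sym: "\<And>a b. f a b = f b a"
    and sym': "\<And>a b. f (a + b) b = f (a + b) a"
  shows "(\<Sum>(a, b, x, y) \<in> reps n. f a b - f (a + b) b) =
    (\<Sum>d | d dvd n. (of_nat (n div d) - 1) * f d d) - (\<Sum>d | d dvd n. \<Sum>b \<in> {0<..<d}. f d b)"
proof -
  define R where "R P G = (\<Sum>(a, b, x, y) \<in> reps n. if P a b x y then G a b else 0)"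
    for P and G :: "nat \<Rightarrow> nat \<Rightarrow> 'a"
  let ?g = "\<lambda>a b. f (a + b) b"
  have "(\<Sum>(a, b, x, y) \<in> reps n. f a b) =
      R (\<lambda>a b x y. a = b) f + R (\<lambda>a b x y. b < a) f + R (\<lambda>a b x y. a < b) f"
    unfolding R_def sum.distrib[symmetric] by (rule sum.cong) auto
  also have "R (\<lambda>a b x y. a < b) f = R (\<lambda>a b x y. b < a) f"
    unfolding R_def by (subst sum_reps_swap, rule sum.cong) (auto simp: sym)
  also have "R (\<lambda>a b x y. b < a) f = R (\<lambda>a b x y. x < y) ?g"
    unfolding R_def by (rule sum_reps_shift)
  finally have f: "(\<Sum>(a, b, x, y) \<in> reps n. f a b) =
      R (\<lambda>a b x y. a = b) f + R (\<lambda>a b x y. x < y) ?g + R (\<lambda>a b x y. x < y) ?g" .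
  have "(\<Sum>(a, b, x, y) \<in> reps n. ?g a b) =
      R (\<lambda>a b x y. x = y) ?g + R (\<lambda>a b x y. x < y) ?g + R (\<lambda>a b x y. y < x) ?g"
    unfolding R_def sum.distrib[symmetric] by (rule sum.cong) auto
  also have "R (\<lambda>a b x y. y < x) ?g = R (\<lambda>a b x y. x < y) ?g"
    unfolding R_def by (subst sum_reps_swap, rule sum.cong) (auto simp: sym' add.commute)
  finally have g: "(\<Sum>(a, b, x, y) \<in> reps n. ?g a b) =
      R (\<lambda>a b x y. x = y) ?g + R (\<lambda>a b x y. x < y) ?g + R (\<lambda>a b x y. x < y) ?g" .
  have "R (\<lambda>a b x y. a = b) f = (\<Sum>(a, b, x, y) \<in> reps n. if a = b then f a a else 0)"
    unfolding R_def by (rule sum.cong) auto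
  then have d: "R (\<lambda>a b x y. a = b) f = (\<Sum>d | d dvd n. (of_nat (n div d) - 1) * f d d)"
    by (simp add: sum_reps_diagonal_ab[OF assms(1), of "\<lambda>a. f a a"])
  have e: "R (\<lambda>a b x y. x = y) ?g = (\<Sum>d | d dvd n. \<Sum>b \<in> {0<..<d}. f d b)"
    unfolding R_def by (rule sum_reps_diagonal_xy[OF assms(1)])
  have "(\<Sum>(a, b, x, y) \<in> reps n. f a b - f (a + b) b) =
      (\<Sum>(a, b, x, y) \<in> reps n. f a b) - (\<Sum>(a, b, x, y) \<in> reps n. ?g a b)"
    unfolding sum_subtractf[symmetric] by (rule sum.cong) auto
  then show ?thesis by (simp add: f g d e)
qed

section \<open>Convolutions of divisor sums\<close>

lemma fps_numeral_mult_nth: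
  "fps_nth (numeral k * f) n = numeral k * fps_nth f n"
  by (simp add: numeral_fps_const)

definition sigma_fps :: "nat \<Rightarrow> complex fps" where
  "sigma_fps r = Abs_fps (\<lambda>n. of_nat (divisor_sigma r n))"

text \<open>
  Every natural number divides \<open>0\<close>, and a sum over an infinite set is \<open>0\<close> by
  convention. So the series above has no constant term, and a product of two such series only involves
  positive indices.
\<close>
lemma divisor_sigma_0 [simp]: "divisor_sigma r 0 = 0"
  by (simp add: divisor_sigma_def)

lemma sigma_fps_nth: "fps_nth (sigma_fps r) n = (\<Sum>d | d dvd n. of_nat d ^ r)"
  by (simp add: sigma_fps_def divisor_sigma_def)

lemma sigma_fps_nth_0 [simp]: "fps_nth (sigma_fps r) 0 = 0"
  by (simp add: sigma_fps_def)

lemma sigma_fps_mult_nth: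
  "fps_nth (sigma_fps i * sigma_fps j) n = (\<Sum>(a, b, x, y) \<in> reps n. of_nat a ^ i * of_nat b ^ j)"
proof -
  have "fps_nth (sigma_fps i * sigma_fps j) n = (\<Sum>m = 0..n. fps_nth (sigma_fps i) m * fps_nth (sigma_fps j) (n - m))"
    by (rule fps_mult_nth)
  also have "\<dots> = (\<Sum>m \<in> {0<..<n}. fps_nth (sigma_fps i) m * fps_nth (sigma_fps j) (n - m))"
    by (rule sum.mono_neutral_right) (auto simp: not_less intro: gr0I)
  also have "\<dots> = (\<Sum>m \<in> {0<..<n}. \<Sum>(a, b) \<in> {a. a dvd m} \<times> {b. b dvd n - m}.
      of_nat a ^ i * of_nat b ^ j)"
    by (simp add: sigma_fps_nth sum_product sum.cartesian_product)
  also have "\<dots> = (\<Sum>(m, a, b) \<in> Sigma {0<..<n} (\<lambda>m. {a. a dvd m} \<times> {b. b dvd n - m}).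
      of_nat a ^ i * of_nat b ^ j)"
    by (subst sum.Sigma) auto
  also have "\<dots> = (\<Sum>(a, b, x, y) \<in> reps n. of_nat a ^ i * of_nat b ^ j)"
    by (rule sum.reindex_bij_witness[of _ "\<lambda>(a, b, x, y). (a * x, a, b)"
          "\<lambda>(m, a, b). (a, b, m div a, (n - m) div b)"])
       (auto simp: reps_def dvd_def intro!: gr0I split: if_splits)
  finally show ?thesis .
qed

lemma q_deriv_sigma_fps_nth: "fps_nth (q_deriv (sigma_fps r)) n = of_nat n * fps_nth (sigma_fps r) n"
  by (cases n) (simp_all add: q_deriv_def)

text \<open>
  The diagonal $a = b$ carries the weight $n/d$; this is the only source of derivatives in the
  convolution formulas.
\<close>
lemma sum_div_mult_power:
  assumes "0 < n"
  shows "(\<Sum>d | d dvd n. of_nat (n div d) * of_nat d ^ Suc r) = fps_nth (q_deriv (sigma_fps r)) n"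
proof -
  have "of_nat (n div d) * of_nat d ^ Suc r = (of_nat n * of_nat d ^ r :: complex)" if "d dvd n" for d
  proof -
    have "(of_nat n :: complex) = of_nat (n div d) * of_nat d"
      using that by (simp flip: of_nat_mult)
    then show ?thesis by simp
  qed
  then show ?thesis
    unfolding q_deriv_sigma_fps_nth sigma_fps_nth sum_distrib_left by (intro sum.cong) auto
qed

lemma power_sums:
  assumes "0 < d"
  shows "6 * (\<Sum>b \<in> {0<..<d}. (of_nat b :: complex) ^ 2) = 2 * of_nat d ^ 3 - 3 * of_nat d ^ 2 + of_nat d"
    and "4 * (\<Sum>b \<in> {0<..<d}. (of_nat b :: complex) ^ 3) = of_nat d ^ 4 - 2 * of_nat d ^ 3 + of_nat d ^ 2"
    and "30 * (\<Sum>b \<in> {0<..<d}. (of_nat b :: complex) ^ 4) =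
      6 * of_nat d ^ 5 - 15 * of_nat d ^ 4 + 10 * of_nat d ^ 3 - of_nat d"
    and "42 * (\<Sum>b \<in> {0<..<d}. (of_nat b :: complex) ^ 6) =
      6 * of_nat d ^ 7 - 21 * of_nat d ^ 6 + 21 * of_nat d ^ 5 - 7 * of_nat d ^ 3 + of_nat d"
proof -
  have *: "{0<..<Suc m} = insert m {0<..<m}" if "0 < m" for m using that by auto
  show "6 * (\<Sum>b \<in> {0<..<d}. (of_nat b :: complex) ^ 2) = 2 * of_nat d ^ 3 - 3 * of_nat d ^ 2 + of_nat d"
    using assms by (induction d rule: nat_induct_non_zero)
      (simp_all add: * distrib_left, simp_all add: algebra_simps eval_nat_numeral)
  show "4 * (\<Sum>b \<in> {0<..<d}. (of_nat b :: complex) ^ 3) = of_nat d ^ 4 - 2 * of_nat d ^ 3 + of_nat d ^ 2"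
    using assms by (induction d rule: nat_induct_non_zero)
      (simp_all add: * distrib_left, simp_all add: algebra_simps eval_nat_numeral)
  show "30 * (\<Sum>b \<in> {0<..<d}. (of_nat b :: complex) ^ 4) =
      6 * of_nat d ^ 5 - 15 * of_nat d ^ 4 + 10 * of_nat d ^ 3 - of_nat d"
    using assms by (induction d rule: nat_induct_non_zero)
      (simp_all add: * distrib_left, simp_all add: algebra_simps eval_nat_numeral)
  show "42 * (\<Sum>b \<in> {0<..<d}. (of_nat b :: complex) ^ 6) =
      6 * of_nat d ^ 7 - 21 * of_nat d ^ 6 + 21 * of_nat d ^ 5 - 7 * of_nat d ^ 3 + of_nat d"
    using assms by (induction d rule: nat_induct_non_zero)
      (simp_all add: * distrib_left, simp_all add: algebra_simps eval_nat_numeral)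
qed

lemma sum_reflect_power:
  "(\<Sum>b \<in> {0<..<d}. (of_nat d - of_nat b :: complex) ^ k) = (\<Sum>b \<in> {0<..<d}. of_nat b ^ k)"
  by (rule sum.reindex_bij_witness[of _ "\<lambda>b. d - b" "\<lambda>b. d - b"]) (auto simp: of_nat_diff)

text \<open>
  This is the coefficient form of $E_4^2 = E_8$. For $f(a, b) = a^2 b^2 (a - b)^2$ the
  difference $f(a, b) - f(a + b, b)$ is $-4 a^3 b^3$, the diagonal $a = b$ contributes nothing, and the
  diagonal $x = y$ leads to $30 \sum_{0 < b < d} d^2 b^2 (d - b)^2 = d^7 - d^3$.
\<close>
lemma sigma3_sigma3:
  "120 * (sigma_fps 3 * sigma_fps 3) = sigma_fps 7 - sigma_fps 3"
proof (rule fps_ext)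
  fix n
  show "fps_nth (120 * (sigma_fps 3 * sigma_fps 3)) n = fps_nth (sigma_fps 7 - sigma_fps 3) n"
  proof (cases "n = 0")
    case False
    define f :: "nat \<Rightarrow> nat \<Rightarrow> complex"
      where "f a b = of_nat a ^ 2 * of_nat b ^ 2 * (of_nat a - of_nat b) ^ 2" for a b
    have inner: "30 * (\<Sum>b \<in> {0<..<d}. f d b) = of_nat d ^ 7 - of_nat d ^ 3" if "d dvd n" for d
    proof -
      have d: "0 < d" using that False by (auto intro: gr0I)
      have "f d b = of_nat d ^ 4 * of_nat b ^ 2 - 2 * of_nat d ^ 3 * of_nat b ^ 3
          + of_nat d ^ 2 * of_nat b ^ 4" for b
        unfolding f_def by (simp add: algebra_simps eval_nat_numeral)
      then have *: "(\<Sum>b \<in> {0<..<d}. f d b) = of_nat d ^ 4 * (\<Sum>b \<in> {0<..<d}. of_nat b ^ 2)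
          - 2 * of_nat d ^ 3 * (\<Sum>b \<in> {0<..<d}. of_nat b ^ 3)
          + of_nat d ^ 2 * (\<Sum>b \<in> {0<..<d}. of_nat b ^ 4)"
        by (simp add: sum.distrib sum_subtractf sum_distrib_left)
      have "30 * (\<Sum>b \<in> {0<..<d}. f d b) =
          5 * of_nat d ^ 4 * (6 * (\<Sum>b \<in> {0<..<d}. of_nat b ^ 2))
          - 15 * of_nat d ^ 3 * (4 * (\<Sum>b \<in> {0<..<d}. of_nat b ^ 3))
          + of_nat d ^ 2 * (30 * (\<Sum>b \<in> {0<..<d}. of_nat b ^ 4))"
        unfolding * by (simp add: algebra_simps)
      also have "\<dots> = of_nat d ^ 7 - of_nat d ^ 3"
        unfolding power_sums[OF d] by (simp add: algebra_simps eval_nat_numeral)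
      finally show ?thesis .
    qed
    have "-4 * (\<Sum>(a, b, x, y) \<in> reps n. of_nat a ^ 3 * of_nat b ^ 3) =
        (\<Sum>(a, b, x, y) \<in> reps n. f a b - f (a + b) b)"
      unfolding sum_distrib_left by (rule sum.cong) (auto simp: f_def algebra_simps eval_nat_numeral)
    also have "\<dots> = (\<Sum>d | d dvd n. (of_nat (n div d) - 1) * f d d)
        - (\<Sum>d | d dvd n. \<Sum>b \<in> {0<..<d}. f d b)"
      by (rule sum_reps_telescope) (use False in \<open>auto simp: f_def algebra_simps eval_nat_numeral\<close>)
    also have "\<dots> = - (\<Sum>d | d dvd n. \<Sum>b \<in> {0<..<d}. f d b)"
      by (simp add: f_def)
    finally have "120 * (\<Sum>(a, b, x, y) \<in> reps n. of_nat a ^ 3 * of_nat b ^ 3) =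
        (\<Sum>d | d dvd n. 30 * (\<Sum>b \<in> {0<..<d}. f d b))"
      unfolding sum_distrib_left[symmetric] by simp
    also have "\<dots> = (\<Sum>d | d dvd n. of_nat d ^ 7 - of_nat d ^ 3)"
      by (rule sum.cong) (auto simp: inner)
    finally show ?thesis
      by (simp add: fps_numeral_mult_nth sigma_fps_mult_nth sigma_fps_nth sum_subtractf)
  qed (simp add: fps_numeral_mult_nth)
qed

text \<open>
  This is the telescoping principle for $f(a, b) = a^k + b^k + (a - b)^k$ with $k = r + 1$ even, for which
  $f(a, b) - f(a + b, b) = (a - b)^k - (a + b)^k$. Expanding the binomials leaves the monomials
  $a^i b^{k-i}$ with $i$ odd, hence convolutions of $\sigma_i$ with $\sigma_{k-i}$.
\<close>
lemma sum_reps_even_power: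
  assumes "0 < n" "odd r"
  shows "(\<Sum>(a, b, x, y) \<in> reps n.
      (of_nat a + of_nat b) ^ Suc r - (of_nat a - of_nat b) ^ Suc r :: complex) =
    (\<Sum>d | d dvd n. of_nat d ^ (r + 2) + of_nat d ^ Suc r + 2 * (\<Sum>b \<in> {0<..<d}. of_nat b ^ Suc r))
      - 2 * fps_nth (q_deriv (sigma_fps r)) n"
proof -
  define k where "k = Suc r"
  have k: "even k" "0 < k" using assms by (simp_all add: k_def)
  define f :: "nat \<Rightarrow> nat \<Rightarrow> complex"
    where "f a b = of_nat a ^ k + of_nat b ^ k + (of_nat a - of_nat b) ^ k" for a b
  have even: "(x - y) ^ k = (y - x) ^ k" for x y :: complex
    by (metis k(1) minus_diff_eq power_minus_even)
  have inner: "(\<Sum>b \<in> {0<..<d}. f d b) =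
      of_nat d ^ (k + 1) - of_nat d ^ k + 2 * (\<Sum>b \<in> {0<..<d}. of_nat b ^ k)" if "d dvd n" for d
  proof -
    have "1 \<le> d" using that assms by (cases d) auto
    then have "of_nat (d - Suc 0) = (of_nat d - 1 :: complex)" by (simp add: of_nat_diff)
    then show ?thesis
      by (simp add: f_def sum.distrib sum_reflect_power left_diff_distrib)
  qed
  have "(\<Sum>(a, b, x, y) \<in> reps n. (of_nat a + of_nat b) ^ k - (of_nat a - of_nat b) ^ k) =
      - (\<Sum>(a, b, x, y) \<in> reps n. f a b - f (a + b) b)"
    unfolding sum_negf[symmetric] by (rule sum.cong) (auto simp: f_def)
  also have "(\<Sum>(a, b, x, y) \<in> reps n. f a b - f (a + b) b) =
      (\<Sum>d | d dvd n. (of_nat (n div d) - 1) * f d d) - (\<Sum>d | d dvd n. \<Sum>b \<in> {0<..<d}. f d b)"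
  proof (rule sum_reps_telescope)
    show "f a b = f b a" for a b unfolding f_def by (subst even) simp
    show "f (a + b) b = f (a + b) a" for a b by (simp add: f_def)
  qed fact
  also have "(\<Sum>d | d dvd n. (of_nat (n div d) - 1) * f d d) =
      2 * fps_nth (q_deriv (sigma_fps r)) n - 2 * (\<Sum>d | d dvd n. of_nat d ^ k)"
    unfolding sum_div_mult_power[OF assms(1), symmetric] sum_distrib_left sum_subtractf[symmetric]
    using k by (intro sum.cong) (simp_all add: f_def k_def algebra_simps)
  also have "(\<Sum>d | d dvd n. \<Sum>b \<in> {0<..<d}. f d b) =
      (\<Sum>d | d dvd n. of_nat d ^ (k + 1) - of_nat d ^ k + 2 * (\<Sum>b \<in> {0<..<d}. of_nat b ^ k))"
    by (rule sum.cong) (auto simp: inner)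
  finally have *: "(\<Sum>(a, b, x, y) \<in> reps n.
        (of_nat a + of_nat b) ^ k - (of_nat a - of_nat b) ^ k :: complex) =
      - (2 * fps_nth (q_deriv (sigma_fps r)) n - 2 * (\<Sum>d | d dvd n. of_nat d ^ k) -
        (\<Sum>d | d dvd n. of_nat d ^ (k + 1) - of_nat d ^ k + 2 * (\<Sum>b \<in> {0<..<d}. of_nat b ^ k)))" .
  have "r + 2 = k + 1" by (simp add: k_def)
  then show ?thesis
    unfolding k_def[symmetric] * by (simp add: sum.distrib sum_subtractf sum_distrib_left)
qed

text \<open>
  The case $k = 4$, where $(a + b)^4 - (a - b)^4 = 8 a^3 b + 8 a b^3$.
\<close>
lemma sigma1_sigma3:
  "240 * (sigma_fps 1 * sigma_fps 3) =
    21 * sigma_fps 5 + 10 * sigma_fps 3 - sigma_fps 1 - 30 * q_deriv (sigma_fps 3)"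
  (is "?l = ?r")
proof (rule fps_ext)
  fix n
  show "fps_nth ?l n = fps_nth ?r n"
  proof (cases "n = 0")
    case False
    have "15 * (of_nat d ^ 5 + of_nat d ^ 4 + 2 * (\<Sum>b \<in> {0<..<d}. of_nat b ^ 4)) =
        21 * of_nat d ^ 5 + 10 * of_nat d ^ 3 - (of_nat d ^ 1 :: complex)" if "d dvd n" for d
    proof -
      have d: "0 < d" using that False by (auto intro: gr0I)
      show ?thesis using power_sums(3)[OF d] by (simp add: algebra_simps)
    qed
    then have "(\<Sum>d | d dvd n. 15 * (of_nat d ^ 5 + of_nat d ^ 4 + 2 * (\<Sum>b \<in> {0<..<d}. of_nat b ^ 4))) =
        (\<Sum>d | d dvd n. 21 * of_nat d ^ 5 + 10 * of_nat d ^ 3 - (of_nat d ^ 1 :: complex))"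
      by (intro sum.cong) auto
    also have "\<dots> = fps_nth (21 * sigma_fps 5 + 10 * sigma_fps 3 - sigma_fps 1) n"
      by (simp add: fps_numeral_mult_nth sigma_fps_nth sum.distrib sum_subtractf sum_distrib_left)
    finally have rhs: "15 * (\<Sum>d | d dvd n. of_nat d ^ 5 + of_nat d ^ 4 + 2 * (\<Sum>b \<in> {0<..<d}. of_nat b ^ 4)) = \<dots>"
      by (simp only: sum_distrib_left)
    have "fps_nth (16 * (sigma_fps 1 * sigma_fps 3)) n =
        8 * fps_nth (sigma_fps 1 * sigma_fps 3) n + 8 * fps_nth (sigma_fps 3 * sigma_fps 1) n"
      by (simp add: fps_numeral_mult_nth mult.commute)
    also have "\<dots> = (\<Sum>(a, b, x, y) \<in> reps n. (of_nat a + of_nat b) ^ 4 - (of_nat a - of_nat b) ^ 4)"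
      unfolding sigma_fps_mult_nth sum_distrib_left sum.distrib[symmetric]
      by (rule sum.cong) (auto simp: algebra_simps eval_nat_numeral)
    also have "\<dots> = (\<Sum>d | d dvd n. of_nat d ^ 5 + of_nat d ^ 4 + 2 * (\<Sum>b \<in> {0<..<d}. of_nat b ^ 4))
        - 2 * fps_nth (q_deriv (sigma_fps 3)) n"
      using sum_reps_even_power[of n 3] False by simp
    finally have *: "(\<Sum>d | d dvd n. of_nat d ^ 5 + of_nat d ^ 4 + 2 * (\<Sum>b \<in> {0<..<d}. of_nat b ^ 4)) =
        16 * fps_nth (sigma_fps 1 * sigma_fps 3) n + 2 * fps_nth (q_deriv (sigma_fps 3)) n"
      by (simp add: fps_numeral_mult_nth)
    show ?thesis
      using rhs unfolding * fps_add_nth fps_sub_nth fps_numeral_mult_nth by (simp add: algebra_simps)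
  qed (simp add: fps_numeral_mult_nth q_deriv_sigma_fps_nth)
qed

text \<open>
  The case $k = 6$, where $(a + b)^6 - (a - b)^6 = 12 a^5 b + 40 a^3 b^3 + 12 a b^5$; the
  middle monomial is removed with the help of the convolution of $\sigma_3$ with itself.
\<close>
lemma sigma1_sigma5:
  "504 * (sigma_fps 1 * sigma_fps 5) =
    20 * sigma_fps 7 + 21 * sigma_fps 5 + sigma_fps 1 - 42 * q_deriv (sigma_fps 5)"
  (is "?l = ?r")
proof (rule fps_ext)
  fix n
  show "fps_nth ?l n = fps_nth ?r n"
  proof (cases "n = 0")
    case False
    have "21 * (of_nat d ^ 7 + of_nat d ^ 6 + 2 * (\<Sum>b \<in> {0<..<d}. of_nat b ^ 6)) =
        27 * of_nat d ^ 7 + 21 * of_nat d ^ 5 - 7 * of_nat d ^ 3 + (of_nat d ^ 1 :: complex)"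
      if "d dvd n" for d
    proof -
      have d: "0 < d" using that False by (auto intro: gr0I)
      show ?thesis using power_sums(4)[OF d] by (simp add: algebra_simps)
    qed
    then have "(\<Sum>d | d dvd n. 21 * (of_nat d ^ 7 + of_nat d ^ 6 + 2 * (\<Sum>b \<in> {0<..<d}. of_nat b ^ 6))) =
        (\<Sum>d | d dvd n. 27 * of_nat d ^ 7 + 21 * of_nat d ^ 5 - 7 * of_nat d ^ 3 + (of_nat d ^ 1 :: complex))"
      by (intro sum.cong) auto
    also have "\<dots> = fps_nth (27 * sigma_fps 7 + 21 * sigma_fps 5 - 7 * sigma_fps 3 + sigma_fps 1) n"
      by (simp add: fps_numeral_mult_nth sigma_fps_nth sum.distrib sum_subtractf sum_distrib_left)
    finally have rhs: "21 * (\<Sum>d | d dvd n. of_nat d ^ 7 + of_nat d ^ 6 + 2 * (\<Sum>b \<in> {0<..<d}. of_nat b ^ 6)) = \<dots>"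
      by (simp only: sum_distrib_left)
    have "fps_nth (24 * (sigma_fps 1 * sigma_fps 5) + 40 * (sigma_fps 3 * sigma_fps 3)) n =
        12 * fps_nth (sigma_fps 1 * sigma_fps 5) n + 12 * fps_nth (sigma_fps 5 * sigma_fps 1) n
        + 40 * fps_nth (sigma_fps 3 * sigma_fps 3) n"
      by (simp add: fps_numeral_mult_nth mult.commute)
    also have "\<dots> = (\<Sum>(a, b, x, y) \<in> reps n. (of_nat a + of_nat b) ^ 6 - (of_nat a - of_nat b) ^ 6)"
      unfolding sigma_fps_mult_nth sum_distrib_left sum.distrib[symmetric]
      by (rule sum.cong) (auto simp: algebra_simps eval_nat_numeral)
    also have "\<dots> = (\<Sum>d | d dvd n. of_nat d ^ 7 + of_nat d ^ 6 + 2 * (\<Sum>b \<in> {0<..<d}. of_nat b ^ 6))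
        - 2 * fps_nth (q_deriv (sigma_fps 5)) n"
      using sum_reps_even_power[of n 5] False by simp
    finally have *: "(\<Sum>d | d dvd n. of_nat d ^ 7 + of_nat d ^ 6 + 2 * (\<Sum>b \<in> {0<..<d}. of_nat b ^ 6)) =
        24 * fps_nth (sigma_fps 1 * sigma_fps 5) n + 40 * fps_nth (sigma_fps 3 * sigma_fps 3) n
        + 2 * fps_nth (q_deriv (sigma_fps 5)) n"
      by (simp add: fps_numeral_mult_nth)
    have "840 * fps_nth (sigma_fps 3 * sigma_fps 3) n =
        7 * fps_nth (120 * (sigma_fps 3 * sigma_fps 3)) n"
      by (simp add: fps_numeral_mult_nth)
    also have "\<dots> = 7 * fps_nth (sigma_fps 7) n - 7 * fps_nth (sigma_fps 3) n"
      unfolding sigma3_sigma3 by (simp add: algebra_simps)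
    finally have **: "27 * fps_nth (sigma_fps 7) n = 20 * fps_nth (sigma_fps 7) n
        + 7 * fps_nth (sigma_fps 3) n + 840 * fps_nth (sigma_fps 3 * sigma_fps 3) n"
      by simp
    show ?thesis
      using rhs unfolding * fps_add_nth fps_sub_nth fps_numeral_mult_nth ** by (simp add: algebra_simps)
  qed (simp add: fps_numeral_mult_nth q_deriv_sigma_fps_nth)
qed

section \<open>The derivatives of the Eisenstein series\<close>

lemma q_deriv_mult: "q_deriv (f * g) = q_deriv f * g + f * q_deriv g"
  by (simp add: q_deriv_def algebra_simps)

lemma q_deriv_sum: "q_deriv (\<Sum>i\<in>A. f i) = (\<Sum>i\<in>A. q_deriv (f i))"
  by (simp add: q_deriv_def fps_deriv_sum sum_distrib_left)

lemma q_deriv_power: "q_deriv (f ^ n) = of_nat n * f ^ (n - 1) * q_deriv f"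
  by (simp add: q_deriv_def fps_deriv_power' algebra_simps)

lemma q_deriv_of_nat [simp]: "q_deriv (of_nat n) = 0"
  by (simp add: q_deriv_def)

definition E2 :: "complex fps" where
  "E2 = 1 - 24 * sigma_fps 1"

lemma E4_eq: "E4 = 1 + 240 * sigma_fps 3"
  by (rule fps_ext) (simp add: E4_def sigma_fps_def fps_numeral_mult_nth)

lemma E6_eq: "E6 = 1 - 504 * sigma_fps 5"
  by (rule fps_ext) (simp add: E6_def sigma_fps_def fps_numeral_mult_nth)

lemma q_deriv_E4: "3 * q_deriv E4 = E2 * E4 - E6"
proof -
  have "q_deriv E4 = 240 * q_deriv (sigma_fps 3)"
    by (simp add: E4_eq q_deriv_def algebra_simps)
  then have *: "3 * q_deriv E4 = 720 * q_deriv (sigma_fps 3)" by simp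
  show ?thesis
    using arg_cong[OF sigma1_sigma3, of "\<lambda>x. 24 * x"]
    unfolding * by (simp add: E2_def E4_eq E6_eq algebra_simps)
qed

lemma q_deriv_E6: "2 * q_deriv E6 = E2 * E6 - E4 ^ 2"
proof -
  have "q_deriv E6 = - 504 * q_deriv (sigma_fps 5)"
    by (simp add: E6_eq q_deriv_def algebra_simps)
  then have *: "2 * q_deriv E6 = - 1008 * q_deriv (sigma_fps 5)" by simp
  show ?thesis
    using arg_cong[OF sigma1_sigma5, of "\<lambda>x. 24 * x"] arg_cong[OF sigma3_sigma3, of "\<lambda>x. 480 * x"]
    unfolding * by (simp add: E2_def E4_eq E6_eq algebra_simps power2_eq_square)
qed

section \<open>Wronskians of geometric sequences\<close>

text \<open>
  The coefficient of ${j \choose l} f^{j-l}$ in $D^i (h f^j)$. It does not depend on $j$, which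
  is what makes the Wronskian matrix factor; the recursion comes from
  $D ({j \choose l} f^{j-l}) = (l + 1) {j \choose l+1} f^{j-(l+1)} Df$. At $l = 0$ the truncated
  $l - 1$ is harmless because of the factor $l$.
\<close>
primrec chain_coeff :: "complex fps \<Rightarrow> complex fps \<Rightarrow> nat \<Rightarrow> nat \<Rightarrow> complex fps" where
  "chain_coeff h f 0 l = (if l = 0 then h else 0)"
| "chain_coeff h f (Suc i) l =
     q_deriv (chain_coeff h f i l) + of_nat l * chain_coeff h f i (l - 1) * q_deriv f"

lemma chain_coeff_eq_0: "i < l \<Longrightarrow> chain_coeff h f i l = 0"
  by (induction i arbitrary: l) (auto simp: q_deriv_def)

lemma chain_coeff_diag: "chain_coeff h f i i = fact i * h * q_deriv f ^ i"
  by (induction i) (simp_all add: chain_coeff_eq_0 q_deriv_def algebra_simps)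

lemma q_deriv_funpow_mult_power:
  assumes "i < k"
  shows "(q_deriv ^^ i) (h * f ^ j) =
    (\<Sum>l<k. chain_coeff h f i l * (of_nat (j choose l) * f ^ (j - l)))"
  using assms
proof (induction i)
  case 0
  then have "(\<Sum>l<k. chain_coeff h f 0 l * (of_nat (j choose l) * f ^ (j - l))) =
      (\<Sum>l\<in>{0}. chain_coeff h f 0 l * (of_nat (j choose l) * f ^ (j - l)))"
    by (intro sum.mono_neutral_right) auto
  then show ?case by simp
next
  case (Suc i)
  let ?C = "chain_coeff h f"
  let ?U = "\<lambda>l. of_nat (j choose l) * f ^ (j - l)"
  obtain k' where k: "k = Suc k'" using Suc.prems by (cases k) auto
  have U: "q_deriv (?U l) = of_nat (Suc l) * ?U (Suc l) * q_deriv f" for l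
  proof -
    have "(j choose l) * (j - l) = Suc l * (j choose Suc l)"
      by (metis binomial_absorb_comp binomial_absorption mult.commute)
    then have "of_nat (j choose l) * of_nat (j - l) = (of_nat (Suc l) * of_nat (j choose Suc l) :: complex fps)"
      by (metis of_nat_mult)
    then show ?thesis
      by (simp add: q_deriv_mult q_deriv_power del: of_nat_Suc binomial_Suc_Suc flip: mult.assoc)
  qed
  have "(q_deriv ^^ Suc i) (h * f ^ j) = q_deriv (\<Sum>l<k. ?C i l * ?U l)"
    using Suc by simp
  also have "\<dots> = (\<Sum>l<k. q_deriv (?C i l) * ?U l)
      + (\<Sum>l<k. of_nat (Suc l) * ?C i l * q_deriv f * ?U (Suc l))"
    by (simp only: q_deriv_sum q_deriv_mult[of "?C i _"] U sum.distrib) (simp only: mult_ac)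
  \<comment> \<open>The last index may be dropped, as the coefficient vanishes above the diagonal;
    this makes room for the index shift that follows.\<close>
  also have "(\<Sum>l<k. of_nat (Suc l) * ?C i l * q_deriv f * ?U (Suc l)) =
      (\<Sum>l<k'. of_nat (Suc l) * ?C i l * q_deriv f * ?U (Suc l))"
    using Suc.prems by (simp add: k chain_coeff_eq_0)
  also have "\<dots> = (\<Sum>l<k. of_nat l * ?C i (l - 1) * q_deriv f * ?U l)"
    unfolding k sum.lessThan_Suc_shift by simp
  finally show ?case
    by (simp add: sum.distrib distrib_right)
qed

text \<open>
  The Wronskian matrix is the product of the lower triangular matrix \<open>L\<close> of the chain rule
  coefficients and the upper unitriangular matrix \<open>U\<close> of the Taylor coefficients of
  $x \mapsto x^j$ at $f$.
\<close>
theorem q_Wronskian_mult_powers: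
  "q_Wronskian (map (\<lambda>j. h * f ^ j) [0..<k]) = (\<Prod>i<k. fact i * h * q_deriv f ^ i)"
proof -
  define L where "L = mat k k (\<lambda>(i, l). chain_coeff h f i l)"
  define U where "U = mat k k (\<lambda>(l, j). of_nat (j choose l) * f ^ (j - l))"
  have L: "L \<in> carrier_mat k k" and U: "U \<in> carrier_mat k k"
    by (simp_all add: L_def U_def)
  have "mat k k (\<lambda>(i, j). (q_deriv ^^ i) (map (\<lambda>j. h * f ^ j) [0..<k] ! j)) = L * U"
    by (rule eq_matI) (auto simp: L_def U_def scalar_prod_def q_deriv_funpow_mult_power[of _ k] atLeast0LessThan)
  then have "q_Wronskian (map (\<lambda>j. h * f ^ j) [0..<k]) = det L * det U"
    using det_mult[OF L U] by (simp add: q_Wronskian_def)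
  also have "det L = (\<Prod>i<k. fact i * h * q_deriv f ^ i)"
    by (subst det_lower_triangular[OF _ L])
       (auto simp: L_def chain_coeff_eq_0 prod_list_diag_prod chain_coeff_diag atLeast0LessThan)
  also have "det U = 1"
    by (subst det_upper_triangular[OF _ U])
       (auto simp: U_def upper_triangular_def prod_list_diag_prod)
  finally show ?thesis by simp
qed
section \<open>The Wronskian of the monomial basis\<close>

text \<open>
  The left-hand side is $E_4^2 E_6 (3 E_6\,DE_4 - 2 E_4\,DE_6)$. In Ramanujan's
  equations the contributions $E_2 E_4 E_6$ cancel, and $E_4^3 - E_6^2$ remains.
\<close>
lemma Wronskian_E4_cubed_E6_squared:
  "q_deriv (E4 ^ 3) * E6 ^ 2 - E4 ^ 3 * q_deriv (E6 ^ 2) = 1728 * Ramanujan_Delta * E4 ^ 2 * E6"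
proof -
  have "1728 * Ramanujan_Delta = fps_const (1728 * (1 / 1728)) * (E4 ^ 3 - E6 ^ 2)"
    unfolding Ramanujan_Delta_def by (simp only: numeral_fps_const fps_const_mult[symmetric] mult.assoc)
  then have D: "1728 * Ramanujan_Delta = E4 ^ 3 - E6 ^ 2" by simp
  have "q_deriv (E4 ^ 3) = 3 * E4 ^ 2 * q_deriv E4" "q_deriv (E6 ^ 2) = 2 * E6 * q_deriv E6"
    by (simp_all add: q_deriv_power)
  then have "q_deriv (E4 ^ 3) * E6 ^ 2 - E4 ^ 3 * q_deriv (E6 ^ 2) =
      E4 ^ 2 * E6 * (E6 * (3 * q_deriv E4) - E4 * (2 * q_deriv E6))"
    by (simp add: algebra_simps eval_nat_numeral)
  also have "\<dots> = E4 ^ 2 * E6 * (E4 ^ 3 - E6 ^ 2)"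
    unfolding q_deriv_E4 q_deriv_E6 by (simp add: algebra_simps eval_nat_numeral)
  finally show ?thesis unfolding D by (simp only: mult_ac)
qed

theorem proposition8p4:
  fixes t :: nat
  assumes "t \<ge> 1"
  shows "\<exists>c :: complex. c \<noteq> 0 \<and>
    q_Wronskian (map (\<lambda>u. (E4 ^ 3) ^ u * (E6 ^ 2) ^ (t - u)) [0..<t + 1]) =
      fps_const c * Ramanujan_Delta ^ (t * (t + 1) div 2)
        * E4 ^ (t * (t + 1)) * E6 ^ (t * (t + 1) div 2)"
proof -
  define A where "A = E4 ^ 3"
  define B where "B = E6 ^ 2"
  define f where "f = A * inverse B"
  define N where "N = t * (t + 1) div 2"
  define c :: complex where "c = of_nat (\<Prod>i<t + 1. fact i) * 1728 ^ N"
  have N: "t * (t + 1) = 2 * N" by (simp add: N_def)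
  have "fps_nth B 0 \<noteq> 0" by (simp add: B_def E6_def)
  then have B: "B * inverse B = 1" by (metis inverse_mult_eq_1 mult.commute)
  then have A: "A = f * B" by (simp add: f_def mult_ac)
  have basis: "A ^ u * B ^ (t - u) = B ^ t * f ^ u" if "u < t + 1" for u
  proof -
    have "B ^ t = B ^ u * B ^ (t - u)" using that by (simp flip: power_add)
    then show ?thesis by (simp add: A power_mult_distrib mult_ac)
  qed
  have "B ^ 2 * q_deriv f = q_deriv A * B - A * q_deriv B"
    by (simp add: A q_deriv_mult algebra_simps power2_eq_square)
  then have Df: "B ^ 2 * q_deriv f = 1728 * Ramanujan_Delta * E4 ^ 2 * E6"
    by (simp add: A_def B_def Wronskian_E4_cubed_E6_squared)
  have "q_Wronskian (map (\<lambda>u. A ^ u * B ^ (t - u)) [0..<t + 1]) =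
      q_Wronskian (map (\<lambda>u. B ^ t * f ^ u) [0..<t + 1])"
    by (rule arg_cong[of _ _ q_Wronskian], rule map_cong[OF refl], rule basis) auto
  also have "\<dots> = (\<Prod>i<t + 1. fact i * B ^ t * q_deriv f ^ i)"
    by (rule q_Wronskian_mult_powers)
  also have "\<dots> = (\<Prod>i<t + 1. fact i) * (B ^ t) ^ (t + 1) * q_deriv f ^ (\<Sum>i<t + 1. i)"
    unfolding prod.distrib power_sum by simp
  also have "(\<Sum>i<t + 1. i) = N"
    using gauss_sum_nat[of t] by (simp add: N_def atMost_atLeast0 lessThan_Suc_atMost)
  also have "(B ^ t) ^ (t + 1) = (B ^ 2) ^ N"
    by (simp only: power_mult[symmetric] N)
  also have "(\<Prod>i<t + 1. fact i) * (B ^ 2) ^ N * q_deriv f ^ N =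
      (\<Prod>i<t + 1. fact i) * (B ^ 2 * q_deriv f) ^ N"
    by (simp only: power_mult_distrib mult.assoc)
  also have "\<dots> = (\<Prod>i<t + 1. fact i) * 1728 ^ N * Ramanujan_Delta ^ N * E4 ^ (2 * N) * E6 ^ N"
    by (simp only: Df power_mult_distrib power_mult mult.assoc)
  also have "(\<Prod>i<t + 1. fact i) * 1728 ^ N = fps_const c"
  proof -
    have "(\<Prod>i<t + 1. fact i) = fps_const (of_nat (\<Prod>i<t + 1. fact i) :: complex)"
      by (subst fps_of_nat) (simp only: of_nat_prod of_nat_fact)
    then show ?thesis
      by (simp only: c_def numeral_fps_const fps_const_power fps_const_mult)
  qed
  finally have "q_Wronskian (map (\<lambda>u. A ^ u * B ^ (t - u)) [0..<t + 1]) =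
      fps_const c * Ramanujan_Delta ^ N * E4 ^ (t * (t + 1)) * E6 ^ N"
    by (simp only: N)
  moreover have "c \<noteq> 0" by (simp add: c_def)
  ultimately show ?thesis unfolding A_def B_def N_def by blast
qed

end
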